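(* In every valid Septoku board $s$, each symbol $k\in\{1,\dots,7\}$ satisfies $|s^{-1}(k)|\ge 5$.
   Context: The Septoku board consists of 37 cells forming a regular hexagon of side 4 in a hexagonal grid, numbered row by row: $1$–$4$ (top row), $5$–$9$, $10$–$15$, $16$–$22$, $23$–$28$, $29$–$33$, $34$–$37$ (bottom row). The 21 "rows" of the board are: horizontal $\{1,2,3,4\}$, $\{5,\dots,9\}$, $\{10,\dots,15\}$, $\{16,\dots,22\}$, $\{23,\dots,28\}$, $\{29,\dots,33\}$, $\{34,\dots,37\}$; up-right $\{1,5,10,16\}$, $\{2,6,11,17,23\}$, $\{3,7,12,18,24,29\}$, $\{4,8,13,19,25,30,34\}$, $\{9,14,20,26,31,35\}$, $\{15,21,27,32,36\}$, $\{22,28,33,37\}$; down-right $\{4,9,15,22\}$, $\{3,8,14,21,28\}$, $\{2,7,13,20,27,33\}$, $\{1,6,12,19,26,32,37\}$, $\{5,11,18,25,31,36\}$, $\{10,17,24,30,35\}$, $\{16,23,29,34\}$. The seven "circles" are: $\{1,2,5,6,7,11,12\}$, $\{3,4,7,8,9,13,14\}$, $\{10,11,16,17,18,23,24\}$, $\{12,13,18,19,20,25,26\}$, $\{14,15,20,21,22,27,28\}$, $\{24,25,29,30,31,34,35\}$, $\{26,27,31,32,33,36,37\}$. A valid Septoku board is a map $s:\{1,\dots,37\}\to\{1,\dots,7\}$ such that the cells of each of the 21 rows receive pairwise distinct values and the seven cells of each circle receive pairwise distinct values. *)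

theory Defs
  imports "HOL-Library.FuncSet"
begin

text \<open>
  The cells of the hexagonal board of side 4 are numbered row by row from the top:

  \<^verbatim>\<open>
              1   2   3   4
            5   6   7   8   9
         10  11  12  13  14  15
       16  17  18  19  20  21  22
         23  24  25  26  27  28
           29  30  31  32  33
             34  35  36  37
  \<close>
\<close>

definition cells :: "nat set" where
  "cells = {1..37}"

definition symbols :: "nat set" where
  "symbols = {1..7}"

definition horizontal_rows :: "nat set set" where
  "horizontal_rows =
    {{1, 2, 3, 4},
     {5, 6, 7, 8, 9},
     {10, 11, 12, 13, 14, 15},
     {16, 17, 18, 19, 20, 21, 22},
     {23, 24, 25, 26, 27, 28},
     {29, 30, 31, 32, 33},
     {34, 35, 36, 37}}"

definition up_right_rows :: "nat set set" where
  "up_right_rows =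
    {{1, 5, 10, 16},
     {2, 6, 11, 17, 23},
     {3, 7, 12, 18, 24, 29},
     {4, 8, 13, 19, 25, 30, 34},
     {9, 14, 20, 26, 31, 35},
     {15, 21, 27, 32, 36},
     {22, 28, 33, 37}}"

definition down_right_rows :: "nat set set" where
  "down_right_rows =
    {{4, 9, 15, 22},
     {3, 8, 14, 21, 28},
     {2, 7, 13, 20, 27, 33},
     {1, 6, 12, 19, 26, 32, 37},
     {5, 11, 18, 25, 31, 36},
     {10, 17, 24, 30, 35},
     {16, 23, 29, 34}}"

definition rows :: "nat set set" where
  "rows = horizontal_rows \<union> up_right_rows \<union> down_right_rows"

definition circles :: "nat set set" where
  "circles =
    {{1, 2, 5, 6, 7, 11, 12},
     {3, 4, 7, 8, 9, 13, 14},
     {10, 11, 16, 17, 18, 23, 24},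
     {12, 13, 18, 19, 20, 25, 26},
     {14, 15, 20, 21, 22, 27, 28},
     {24, 25, 29, 30, 31, 34, 35},
     {26, 27, 31, 32, 33, 36, 37}}"

text \<open>Values of a board outside \<^term>\<open>cells\<close> are unconstrained and irrelevant.\<close>

definition valid_board :: "(nat \<Rightarrow> nat) \<Rightarrow> bool" where
  "valid_board s \<longleftrightarrow>
    s \<in> cells \<rightarrow> symbols \<and>
    (\<forall>R \<in> rows. inj_on s R) \<and>
    (\<forall>C \<in> circles. inj_on s C)"

end

theory Submission
  imports Defs
begin

text \<open>
  Seven cells with distinct symbols out of seven show every symbol, so the set \<open>S\<close> of cells
  showing \<open>k\<close> meets each of the seven circles. Every cell lies in at most two circles, and twelve
  cells, the points and inner corners of a six-pointed star around the central cell, lie in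
  exactly two. The rows and circles leave at most two of these twelve to \<open>S\<close>: at most one inner
  corner, at most one point of each of the two large triangles of the star, and two points
  sharing no circle are opposite, in which case their rows through the star cover all inner
  corners. Counting incidences between \<open>S\<close> and the circles, \<open>7 \<le> card S + 2\<close>.
\<close>

text \<open>The six neighbours of the central cell 19, which itself lies in only one circle.\<close>

definition inner_corners :: "nat set" where
  "inner_corners = {12, 13, 18, 20, 25, 26}"

definition triangle_up :: "nat set" where
  "triangle_up = {7, 24, 27}"

definition triangle_down :: "nat set" where
  "triangle_down = {11, 14, 31}"

definition shared_cells :: "nat set" where
  "shared_cells = inner_corners \<union> triangle_up \<union> triangle_down"

lemma card_circles: "card circles = 7"
  by (simp add: circles_def card_insert_if set_eq_subset)

lemma circle_subset_cells: "C \<in> circles \<Longrightarrow> C \<subseteq> cells"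
  by (auto simp: circles_def cells_def)

lemma card_circle: "C \<in> circles \<Longrightarrow> card C = 7"
  by (auto simp: circles_def)

lemma card_circles_containing:
  assumes "c \<in> cells"
  shows "card {C \<in> circles. c \<in> C} \<le> (if c \<in> shared_cells then 2 else 1)"
proof -
  \<comment> \<open>A filter that rewrites along \<open>insert\<close> lets the simplifier compute
    the circles through a concrete cell.\<close>
  define containing where "containing \<A> = {C \<in> \<A>. c \<in> C}" for \<A> :: "nat set set"
  have containing_insert: "containing (insert A \<A>) =
      (if c \<in> A then insert A (containing \<A>) else containing \<A>)" for A \<A>
    by (auto simp: containing_def)
  have containing_empty: "containing {} = {}"
    by (simp add: containing_def)
  \<comment> \<open>The cell 1 is split off because \<open>upt\<close> unfolds between numerals, and
    \<open>1\<close> is not of the form \<open>numeral n\<close>.\<close>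
  have "cells = insert 1 (set [2..<38])"
    by (simp only: set_upt cells_def) auto
  then have "c \<in> insert 1 (set [2..<38])"
    using assms by simp
  then have "card (containing circles) \<le> (if c \<in> shared_cells then 2 else 1)"
    by (simp, elim disjE)
      (simp_all add: circles_def containing_insert containing_empty card_insert_if
        shared_cells_def inner_corners_def triangle_up_def triangle_down_def)
  then show ?thesis
    by (simp only: containing_def)
qed

lemma circle_image:
  assumes "valid_board s" "C \<in> circles"
  shows "s ` C = symbols"
proof (rule card_subset_eq)
  show "finite symbols" by (simp add: symbols_def)
  show "s ` C \<subseteq> symbols"
    using assms circle_subset_cells by (fastforce simp: valid_board_def)
  show "card (s ` C) = card symbols"
    using assms card_circle by (simp add: valid_board_def card_image symbols_def)
qed

text \<open>Every cell of the board conflicts with itself, so pairwise claims over a set can include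
  equal cells.\<close>

definition conflicting :: "nat \<Rightarrow> nat \<Rightarrow> bool" where
  "conflicting x y \<longleftrightarrow> (\<exists>R \<in> rows \<union> circles. x \<in> R \<and> y \<in> R)"

lemma conflicting_eqD:
  assumes "valid_board s" "conflicting x y" "s x = s y"
  shows "x = y"
  using assms by (auto simp: valid_board_def conflicting_def dest: inj_onD)

text \<open>Inner corners share the central circle, points of one triangle share a row along its
  side, and neighbouring points of the star share an outer circle. For the opposite points 7 and 31,
  rows through 7 reach 12, 18, 13, 20 and rows through 31 reach 20, 26, 18, 25.\<close>

lemma star_conflicting:
  shows "\<forall>x\<in>inner_corners. \<forall>y\<in>inner_corners. conflicting x y"
    and "\<forall>x\<in>triangle_up. \<forall>y\<in>triangle_up. conflicting x y"
    and "\<forall>x\<in>triangle_down. \<forall>y\<in>triangle_down. conflicting x y"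
    and "\<forall>x\<in>inner_corners. \<forall>y\<in>triangle_up. \<forall>z\<in>triangle_down.
      conflicting x y \<or> conflicting x z \<or> conflicting y z"
  by (simp_all add: inner_corners_def triangle_up_def triangle_down_def conflicting_def
    rows_def horizontal_rows_def up_right_rows_def down_right_rows_def circles_def)

lemma star_disjoint:
  "inner_corners \<inter> triangle_up = {}" "inner_corners \<inter> triangle_down = {}"
  "triangle_up \<inter> triangle_down = {}"
  by (auto simp: inner_corners_def triangle_up_def triangle_down_def)

lemma card_conflicting_le_1:
  assumes "valid_board s" "\<forall>x\<in>A. \<forall>y\<in>A. conflicting x y"
  shows "card {c \<in> A. s c = k} \<le> 1"
\<comment> \<open>An infinite set has \<open>card\<close> 0, so only the finite case needs an
  argument.\<close>
proof (cases "finite {c \<in> A. s c = k}")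
  case True
  have "\<forall>x\<in>{c \<in> A. s c = k}. \<forall>y\<in>{c \<in> A. s c = k}. x = y"
    using assms conflicting_eqD[OF assms(1)] by simp
  then show ?thesis
    using card_le_Suc0_iff_eq[OF True] by simp
qed simp

lemma card_shared_le_2:
  assumes "valid_board s"
  shows "card {c \<in> shared_cells. s c = k} \<le> 2"
proof -
  let ?I = "{c \<in> inner_corners. s c = k}"
  let ?U = "{c \<in> triangle_up. s c = k}"
  let ?D = "{c \<in> triangle_down. s c = k}"
  have "?I = {} \<or> ?U = {} \<or> ?D = {}"
  proof (rule ccontr)
    assume "\<not> ?thesis"
    then obtain x y z where "x \<in> ?I" "y \<in> ?U" "z \<in> ?D"
      by blast
    moreover from this have "conflicting x y \<or> conflicting x z \<or> conflicting y z"
      using star_conflicting(4) by blast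
    \<comment> \<open>All three cells show \<open>k\<close>, so a conflicting pair coincides,
      although its cells come from disjoint parts.\<close>
    ultimately show False
      using conflicting_eqD[OF assms] star_disjoint by fastforce
  qed
  moreover have "card ?I \<le> 1" "card ?U \<le> 1" "card ?D \<le> 1"
    using card_conflicting_le_1[OF assms] star_conflicting by simp_all
  moreover have "card {c \<in> shared_cells. s c = k} \<le> card ?I + card ?U + card ?D"
  proof -
    have "{c \<in> shared_cells. s c = k} = ?I \<union> ?U \<union> ?D"
      by (auto simp: shared_cells_def)
    then show ?thesis
      using card_Un_le[of ?I ?U] card_Un_le[of "?I \<union> ?U" ?D] by simp
  qed
  ultimately show ?thesis
    by (elim disjE) simp_all
qed

theorem theorem3:
  fixes s :: "nat \<Rightarrow> nat" and k :: nat
  assumes "valid_board s" and "k \<in> symbols"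
  shows "card {c \<in> cells. s c = k} \<ge> 5"
proof -
  let ?S = "{c \<in> cells. s c = k}"
  have fin: "finite ?S" "finite circles"
    by (simp_all add: cells_def circles_def)
  have "1 \<le> card {c \<in> ?S. c \<in> C}" if "C \<in> circles" for C
  proof -
    have "k \<in> s ` C"
      using circle_image assms that by blast
    then have "{c \<in> ?S. c \<in> C} \<noteq> {}"
      using circle_subset_cells[OF that] by blast
    moreover have "finite {c \<in> ?S. c \<in> C}"
      using fin(1) by (rule finite_subset[rotated]) auto
    ultimately show ?thesis
      by (metis One_nat_def Suc_le_eq card_gt_0_iff)
  qed
  then have "(\<Sum>C\<in>circles. 1) \<le> (\<Sum>C\<in>circles. card {c \<in> ?S. c \<in> C})"
    by (rule sum_mono)
  also have "\<dots> = (\<Sum>c\<in>?S. card {C \<in> circles. c \<in> C})"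
    using fin by (intro sum_multicount_gen) auto
  \<comment> \<open>Splitting 2 as 1 + 1 separates the count of all cells showing \<open>k\<close>
    from that of the shared ones.\<close>
  also have "\<dots> \<le> (\<Sum>c\<in>?S. 1 + (if c \<in> shared_cells then 1 else 0))"
    using card_circles_containing by (intro sum_mono) fastforce
  also have "\<dots> = card ?S + card {c \<in> ?S. c \<in> shared_cells}"
    using fin(1) by (simp only: sum.distrib sum.inter_filter[symmetric] card_eq_sum)
  also have "{c \<in> ?S. c \<in> shared_cells} = {c \<in> shared_cells. s c = k}"
    by (auto simp: cells_def shared_cells_def inner_corners_def triangle_up_def triangle_down_def)
  also have "card \<dots> \<le> 2"
    using card_shared_le_2 assms(1) by blast
  finally show ?thesis
    by (simp add: card_circles)
qed

end
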